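(* Let $A(X)$ be a polynomial with non-negative integer coefficients and let $\Phi_{m_1}(X),\dots,\Phi_{m_k}(X)$ be distinct cyclotomic polynomials each of which divides $A(X)$. Assume that there exist distinct prime numbers $p,q$ and exponents $\alpha_j,\beta_j\in\mathbb{N}\cup\{0\}$ such that $m_j=p^{\alpha_j}q^{\beta_j}$ for each $1\le j\le k$. Assume further that $q\nmid A(1)$. Then $$A(1)\ \ge\ p^{E_p},\qquad\text{where } E_p=|\{\alpha_1,\dots,\alpha_k\}|,$$ that is, $E_p$ is the number of distinct exponents $\alpha_j$ appearing among the $m_j=p^{\alpha_j}q^{\beta_j}$.
   Context: $\Phi_s(X)$ denotes the $s$-th cyclotomic polynomial, i.e. the monic irreducible polynomial in $\mathbb{Z}[X]$ whose roots are exactly the primitive $s$-th roots of unity. $\mathbb{N}$ denotes the positive integers. *)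

theory Defs
  imports "HOL-Computational_Algebra.Computational_Algebra"
begin

definition primitive_root_of_unity :: "nat \<Rightarrow> complex \<Rightarrow> bool" where
  "primitive_root_of_unity s z \<longleftrightarrow>
     s > 0 \<and> z ^ s = 1 \<and> (\<forall>t. 0 < t \<and> t < s \<longrightarrow> z ^ t \<noteq> 1)"

definition is_cyclotomic_poly :: "nat \<Rightarrow> int poly \<Rightarrow> bool" where
  "is_cyclotomic_poly s P \<longleftrightarrow>
     lead_coeff P = 1 \<and> irreducible P \<and>
     {z :: complex. poly (map_poly of_int P) z = 0} = {z. primitive_root_of_unity s z}"

(* For s > 0 exactly one P qualifies, by is_cyclotomic_poly_cyclotomic_poly and
   is_cyclotomic_poly_unique below; cyclotomic_poly 0 is unspecified. *)
definition cyclotomic_poly :: "nat \<Rightarrow> int poly" where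
  "cyclotomic_poly s = (THE P. is_cyclotomic_poly s P)"


abbreviation ev :: "complex \<Rightarrow> int poly \<Rightarrow> complex" where
  "ev z f \<equiv> poly (map_poly of_int f) z"

lemma ev_pCons: "ev z (pCons a f) = of_int a + z * ev z f"
  by (simp add: map_poly_pCons)

lemma ev_add: "ev z (f + g) = ev z f + ev z g"
proof -
  have "map_poly of_int (f + g) = (map_poly of_int f + map_poly of_int g :: complex poly)"
    by (intro poly_eqI) (simp add: coeff_map_poly)
  then show ?thesis by simp
qed

lemma ev_smult: "ev z (smult c f) = of_int c * ev z f"
proof -
  have "map_poly of_int (smult c f) = (smult (of_int c) (map_poly of_int f) :: complex poly)"
    by (intro poly_eqI) (simp add: coeff_map_poly)
  then show ?thesis by simp
qed

lemma ev_diff: "ev z (f - g) = ev z f - ev z g"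
  using ev_add[where z = z and f = f and g = "smult (-1) g"] ev_smult[where z = z and c = "-1" and f = g] by simp

lemma ev_mult: "ev z (f * g) = ev z f * ev z g"
  by (induction f) (simp_all add: ev_add ev_smult ev_pCons algebra_simps)

lemma ev_power: "ev z (f ^ n) = ev z f ^ n"
  by (induction n) (simp_all add: ev_mult)

lemma ev_monom: "ev z (monom c n) = of_int c * z ^ n"
  by (simp add: map_poly_monom poly_monom)

lemma ev_pcompose: "ev z (pcompose f g) = ev (ev z g) f"
  by (induction f) (simp_all add: pcompose_pCons ev_add ev_mult ev_pCons)

lemmas ev_simps = ev_add ev_diff ev_smult ev_mult ev_power ev_monom ev_pcompose

lemma prime_dvd_freshman:
  fixes a b :: "'a :: comm_ring_1"
  assumes p: "prime p"
  shows "of_nat p dvd (a + b) ^ p - a ^ p - b ^ p"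
proof -
  have p2: "p \<ge> 2" using p by (simp add: prime_ge_2_nat)
  have split: "{..p} = insert 0 (insert p {0<..<p})" using p2 by auto
  have "(a + b) ^ p = (\<Sum>k\<le>p. of_nat (p choose k) * a ^ k * b ^ (p - k))"
    by (rule binomial_ring)
  also have "\<dots> = a ^ p + b ^ p + (\<Sum>k\<in>{0<..<p}. of_nat (p choose k) * a ^ k * b ^ (p - k))"
    unfolding split using p2 by simp
  finally have eq: "(a + b) ^ p - a ^ p - b ^ p =
      (\<Sum>k\<in>{0<..<p}. of_nat (p choose k) * a ^ k * b ^ (p - k))" by simp
  have "of_nat p dvd (of_nat (p choose k) * a ^ k * b ^ (p - k) :: 'a)" if "k \<in> {0<..<p}" for k
  proof -
    have "p dvd (p choose k)" using that p by (intro dvd_choose_prime) auto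
    then obtain c where "p choose k = p * c" by (rule dvdE)
    then have "of_nat p dvd (of_nat (p choose k) :: 'a)" by simp
    then show ?thesis by (simp add: mult.assoc dvd_mult2)
  qed
  then show ?thesis unfolding eq by (rule dvd_sum)
qed

lemma prime_dvd_fermat:
  fixes a :: int
  assumes p: "prime p"
  shows "int p dvd a ^ p - a"
proof -
  have p0: "p > 0" using p by (simp add: prime_gt_0_nat)
  have nat: "int p dvd int n ^ p - int n" for n
  proof (induction n)
    case 0
    then show ?case using p0 by (simp add: power_0_left)
  next
    case (Suc n)
    have "int p dvd (int n + 1) ^ p - int n ^ p - 1 ^ p"
      using prime_dvd_freshman[OF p, of "int n" 1] by simp
    from dvd_add[OF this Suc] show ?case by (simp add: algebra_simps)
  qed
  show ?thesis
  proof (cases "a \<ge> 0")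
    case True
    then show ?thesis using nat[of "nat a"] by simp
  next
    case False
    then have 1: "int p dvd (-a) ^ p - (-a)" using nat[of "nat (-a)"] by simp
    have "int p dvd (a + (-a)) ^ p - a ^ p - (-a) ^ p"
      using prime_dvd_freshman[OF p, of a "-a"] by simp
    with p0 have "int p dvd - (a ^ p) - (-a) ^ p" by (simp add: power_0_left)
    from dvd_add[OF this 1] have "int p dvd - (a ^ p - a)" by simp
    then show ?thesis by (simp only: dvd_minus_iff)
  qed
qed

lemma frobenius_poly:
  fixes f :: "int poly"
  assumes p: "prime p"
  shows "of_nat p dvd f ^ p - pcompose f (monom 1 p)"
proof (induction f)
  case 0
  then show ?case using p by (simp add: power_0_left prime_gt_0_nat)
next
  case (pCons a f)
  let ?X = "monom 1 1 :: int poly"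
  have eq: "pCons a f = [:a:] + ?X * f" by (simp add: monom_altdef)
  have "of_nat p dvd ([:a:] + ?X * f) ^ p - [:a:] ^ p - (?X * f) ^ p"
    by (rule prime_dvd_freshman[OF p])
  moreover have "of_nat p dvd [:a:] ^ p - [:a:]"
  proof -
    obtain c where "a ^ p - a = int p * c" using prime_dvd_fermat[OF p, of a] by (rule dvdE)
    then have "[:a:] ^ p - [:a:] = of_nat p * [:c:]"
      by (simp add: poly_const_pow of_nat_poly)
    then show ?thesis by (rule dvdI)
  qed
  moreover have "of_nat p dvd monom 1 p * (f ^ p - pcompose f (monom 1 p))"
    using pCons(2) by (rule dvd_mult)
  ultimately have "of_nat p dvd ([:a:] + ?X * f) ^ p - [:a:] ^ p - (?X * f) ^ p
      + ([:a:] ^ p - [:a:]) + monom 1 p * (f ^ p - pcompose f (monom 1 p))"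
    by (intro dvd_add)
  also have "\<dots> = ([:a:] + ?X * f) ^ p - pcompose (pCons a f) (monom 1 p)"
    by (simp add: pcompose_pCons power_mult_distrib monom_power algebra_simps)
  finally show ?case by (simp only: eq)
qed

lemma root_degree_pos:
  assumes "ev z g = 0" "g \<noteq> 0"
  shows "degree g > 0"
proof (rule ccontr)
  assume "\<not> degree g > 0"
  then obtain c where "g = [:c:]" by (auto elim: degree_eq_zeroE)
  with assms show False by (simp add: ev_pCons)
qed

lemma irreducible_root_dvd:
  fixes f g :: "int poly"
  assumes irr: "irreducible f" and f: "ev z f = 0" and g: "ev z g = 0"
  shows "f dvd g"
proof -
  have f0: "f \<noteq> 0" using irr by auto
  define h where "h = (ARG_MIN degree h. h \<noteq> 0 \<and> ev z h = 0)"
  have h: "h \<noteq> 0" "ev z h = 0" 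
    using arg_min_natI[of "\<lambda>h. h \<noteq> 0 \<and> ev z h = 0" f degree] f0 f unfolding h_def by auto
  have hmin: "degree h \<le> degree u" if "u \<noteq> 0" "ev z u = 0" for u
    using arg_min_nat_le[of "\<lambda>h. h \<noteq> 0 \<and> ev z h = 0" u degree] that unfolding h_def by auto
  have div: "\<exists>c q. c \<noteq> 0 \<and> smult c u = h * q" if u: "ev z u = 0" for u
  proof -
    obtain c q where c: "c \<noteq> 0" and eq: "smult c u = h * q + pseudo_mod u h"
      using pseudo_mod(1)[OF h(1)] by blast
    have "ev z (pseudo_mod u h) = ev z (smult c u - h * q)" using eq by simp
    also have "\<dots> = 0" by (simp add: ev_simps u h)
    finally have "pseudo_mod u h = 0"
      using hmin[of "pseudo_mod u h"] pseudo_mod(2)[OF h(1), of u] by force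
    with eq c show ?thesis by auto
  qed
  have prime: "prime_elem f" using irr by (rule irreducible_imp_prime_elem)
  have df: "degree f > 0" using root_degree_pos[OF f f0] .
  have dh: "degree h > 0" using root_degree_pos[OF h(2,1)] .
  obtain c q where c: "c \<noteq> 0" and cq: "smult c f = h * q" using div[OF f] by blast
  have "f dvd h * q" unfolding cq[symmetric] by (rule dvd_smult) simp
  then have "f dvd h"
  proof (cases "f dvd q")
    case True
    then obtain s where s: "q = f * s" by (rule dvdE)
    have "f * [:c:] = f * (h * s)" using cq s by (simp add: algebra_simps)
    then have hs: "[:c:] = h * s" using f0 by (simp only: mult_cancel_left) auto
    moreover have "s \<noteq> 0" using hs c by auto
    ultimately have "degree [:c:] = degree h + degree s" using h(1) by (metis degree_mult_eq)
    with dh show ?thesis by simp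
  next
    case False
    with \<open>f dvd h * q\<close> prime show ?thesis by (simp add: prime_elem_dvd_mult_iff)
  qed
  obtain d r where d: "d \<noteq> 0" and dr: "smult d g = h * r" using div[OF g] by blast
  have "f dvd smult d g" using \<open>f dvd h\<close> dr by (simp add: dvd_mult2)
  then have "f dvd [:d:] * g" by simp
  then have "f dvd [:d:] \<or> f dvd g" using prime by (simp only: prime_elem_dvd_mult_iff)
  moreover have "\<not> f dvd [:d:]"
    using dvd_imp_degree_le[of f "[:d:]"] d df by auto
  ultimately show ?thesis by blast
qed

lemma monic_divmod:
  fixes f g :: "int poly"
  assumes "lead_coeff f = 1"
  shows "\<exists>q r. g = f * q + r \<and> (r = 0 \<or> degree r < degree f)"
proof -
  have f0: "f \<noteq> 0" using assms by auto
  obtain q r where qr: "pseudo_divmod g f = (q, r)" by (cases "pseudo_divmod g f")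
  from pseudo_divmod[OF f0 qr] show ?thesis using assms by auto
qed

lemma root_power_prime:
  fixes f :: "int poly"
  assumes irr: "irreducible f" and monic: "lead_coeff f = 1"
    and n: "n > 0" and z: "z ^ n = 1" and f: "ev z f = 0"
    and p: "prime p" and pn: "\<not> p dvd n"
  shows "ev (z ^ p) f = 0"
proof (rule ccontr)
  assume nz: "ev (z ^ p) f \<noteq> 0"
  define F :: "int poly" where "F = monom 1 n - 1"
  have "f dvd F"
    by (rule irreducible_root_dvd[OF irr f]) (simp add: F_def ev_simps z)
  then obtain h where h: "F = f * h" by (rule dvdE)
  have "(z ^ p) ^ n = 1" using z by (metis power_mult mult.commute power_one)
  then have "ev (z ^ p) F = 0" by (simp add: F_def ev_simps)
  with nz have hz: "ev (z ^ p) h = 0" by (simp add: h ev_simps)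
  obtain g where g: "f ^ p - pcompose f (monom 1 p) = of_nat p * g"
    using frobenius_poly[OF p, of f] by (rule dvdE)
  have "pcompose f (monom 1 p) = f ^ p - smult (int p) g"
    using g by (simp add: algebra_simps of_nat_poly)
  then have "ev z (pcompose f (monom 1 p)) = ev z (f ^ p - smult (int p) g)" by simp
  then have fz: "ev (z ^ p) f = - of_nat p * ev z g"
    using f p by (simp add: ev_simps power_0_left prime_gt_0_nat)
  have "pderiv F = monom (int n) (n - 1)" by (simp add: F_def pderiv_diff pderiv_monom)
  then have "ev (z ^ p) (monom (int n) (n - 1)) = ev (z ^ p) (f * pderiv h + h * pderiv f)"
    by (simp add: h pderiv_mult)
  then have "of_nat n * (z ^ p) ^ (n - 1) = ev (z ^ p) f * ev (z ^ p) (pderiv h)"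
    by (simp add: ev_simps hz)
  then have "of_nat n * ((z ^ p) ^ (n - 1) * z ^ p) = ev (z ^ p) f * ev (z ^ p) (pderiv h) * z ^ p"
    by (metis mult.assoc)
  moreover have "(z ^ p) ^ (n - 1) * z ^ p = 1"
    using n \<open>(z ^ p) ^ n = 1\<close> by (simp flip: power_Suc2)
  ultimately have nn: "of_nat n = ev (z ^ p) f * ev (z ^ p) (pderiv h) * z ^ p" by (metis mult.right_neutral)
  define G where "G = - g * pcompose (pderiv h) (monom 1 p) * monom 1 p"
  have ev_uminus: "ev z (- g) = - ev z g" for g using ev_diff[where z = z and f = 0 and g = g] by simp
  then have "of_nat n = of_nat p * ev z G"
    unfolding nn fz G_def by (simp add: ev_simps ev_uminus)
  obtain q r where qr: "G = f * q + r" and r: "r = 0 \<or> degree r < degree f"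
    using monic_divmod[OF monic] by blast
  have "ev z G = ev z r" using f by (simp add: qr ev_simps)
  with \<open>of_nat n = of_nat p * ev z G\<close> have "ev z ([:int n:] - smult (int p) r) = 0"
    by (simp add: ev_simps ev_pCons)
  then have "f dvd [:int n:] - smult (int p) r" by (rule irreducible_root_dvd[OF irr f])
  moreover have df: "degree f > 0" using root_degree_pos[OF f] irr by (metis not_irreducible_zero)
  then have "degree ([:int n:] - smult (int p) r) < degree f"
    using r by (intro degree_diff_less) (auto intro: le_less_trans[OF degree_smult_le])
  ultimately have "[:int n:] - smult (int p) r = 0"
    using dvd_imp_degree_le linorder_not_le by blast
  then have "coeff ([:int n:] - smult (int p) r) 0 = 0" by simp
  then have "int n = int p * coeff r 0" by simp
  then have "int p dvd int n" by (rule dvdI)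
  with pn show False by simp
qed

lemma root_power_coprime:
  fixes f :: "int poly"
  assumes irr: "irreducible f" and monic: "lead_coeff f = 1" and n: "n > 0"
  shows "z ^ n = 1 \<Longrightarrow> ev z f = 0 \<Longrightarrow> coprime k n \<Longrightarrow> ev (z ^ k) f = 0"
proof (induction k arbitrary: z rule: less_induct)
  case (less k)
  consider "k = 0" | "k = 1" | "k > 1" by linarith
  then show ?case
  proof cases
    case 1
    with less.prems n have "n = 1" by simp
    with 1 less.prems show ?thesis by simp
  next
    case 2
    with less.prems show ?thesis by simp
  next
    case 3
    then obtain p where p: "prime p" "p dvd k" using prime_factor_nat[of k] by auto
    then obtain l where l: "k = p * l" by (auto elim: dvdE)
    have cop: "coprime p n" "coprime l n" using less.prems(3) l by auto
    have pn: "\<not> p dvd n" using cop(1) p(1) by (metis coprime_absorb_left not_prime_unit)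
    have "l < k" using l 3 prime_gt_1_nat[OF p(1)] by (auto intro: Nat.gr0I)
    moreover have "(z ^ p) ^ n = 1"
      using less.prems(1) by (metis power_mult mult.commute power_one)
    moreover have "ev (z ^ p) f = 0"
      by (rule root_power_prime[OF irr monic n less.prems(1,2) p(1) pn])
    ultimately have "ev ((z ^ p) ^ l) f = 0" using less.IH[of l "z ^ p"] cop(2) by blast
    then show ?thesis by (simp add: l power_mult)
  qed
qed

lemma primitive_root_cis:
  assumes "n > 0"
  shows "primitive_root_of_unity n (cis (2 * pi / n))"
    and "w ^ n = 1 \<Longrightarrow> \<exists>k<n. w = cis (2 * pi / n) ^ k"
proof -
  let ?f = "\<lambda>k::nat. cis (2 * pi * real k / real n)"
  have pow: "cis (2 * pi / n) ^ k = ?f k" for k by (simp add: DeMoivre mult_ac)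
  have bij: "bij_betw ?f {..<n} {z. z ^ n = 1}" using bij_betw_roots_unity[OF assms] .
  have "cis (2 * pi / n) ^ t \<noteq> 1" if "0 < t" "t < n" for t
  proof
    assume "cis (2 * pi / n) ^ t = 1"
    then have "?f t = ?f 0" by (simp add: pow)
    from inj_onD[OF bij_betw_imp_inj_on[OF bij] this] that assms show False by simp
  qed
  moreover have "cis (2 * pi / n) ^ n = 1" using assms by (simp add: pow)
  ultimately show "primitive_root_of_unity n (cis (2 * pi / n))"
    using assms by (simp add: primitive_root_of_unity_def)
  assume "w ^ n = 1"
  then have "w \<in> ?f ` {..<n}" using bij_betw_imp_surj_on[OF bij] by simp
  then show "\<exists>k<n. w = cis (2 * pi / n) ^ k" by (auto simp: pow)
qed

lemma is_cyclotomic_poly_exists: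
  assumes n: "n > 0"
  shows "\<exists>P. is_cyclotomic_poly n P"
proof -
  define z where "z = cis (2 * pi / n)"
  have prim: "primitive_root_of_unity n z" using primitive_root_cis(1)[OF n] by (simp add: z_def)
  then have zn: "z ^ n = 1" and zt: "\<And>t. 0 < t \<Longrightarrow> t < n \<Longrightarrow> z ^ t \<noteq> 1"
    by (auto simp: primitive_root_of_unity_def)
  define F :: "nat \<Rightarrow> int poly" where "F = (\<lambda>t. monom 1 t - 1)"
  have evF: "ev w (F t) = w ^ t - 1" for w t by (simp add: F_def ev_simps)
  have F0: "F n \<noteq> 0"
  proof
    assume "F n = 0"
    then have "coeff (F n) n = 0" by simp
    with n show False by (simp add: F_def)
  qed
  have degF: "degree (F n) = n"
    using n unfolding F_def by (intro antisym degree_diff_le le_degree) (auto simp: degree_monom_eq)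
  have lcF: "lead_coeff (F n) = 1" using n by (simp add: degF) (simp add: F_def)
  obtain P0 where P0: "irreducible P0" "P0 dvd F n" "ev z P0 = 0"
  proof -
    obtain A where A: "\<And>x. x \<in># A \<Longrightarrow> prime_elem x" "normalize (prod_mset A) = normalize (F n)"
      using prime_factorization_exists[OF F0] by blast
    have "ev z (prod_mset A) = 0"
    proof -
      have "F n dvd prod_mset A" using A(2) by (simp add: associated_iff_dvd)
      then obtain u where "prod_mset A = F n * u" by (rule dvdE)
      then show ?thesis by (simp add: ev_simps evF zn)
    qed
    then have "\<exists>x. x \<in># A \<and> ev z x = 0"
      by (induction A) (auto simp: ev_simps)
    then obtain x where x: "x \<in># A" "ev z x = 0" by blast
    moreover have "x dvd F n" using A(2) x(1) by (metis dvd_normalize_iff dvd_prod_mset)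
    moreover have "irreducible x" using A(1)[OF x(1)] by (rule prime_elem_imp_irreducible)
    ultimately show ?thesis using that by blast
  qed
  obtain u where "F n = P0 * u" using P0(2) by (rule dvdE)
  then have "lead_coeff P0 * lead_coeff u = 1" using lcF by (simp add: lead_coeff_mult)
  then have lc: "lead_coeff P0 = 1 \<or> lead_coeff P0 = -1" by (metis zmult_eq_1_iff)
  define P where "P = smult (lead_coeff P0) P0"
  have monic: "lead_coeff P = 1" using lc by (auto simp: P_def lead_coeff_smult)
  have "P = P0 \<or> P = - P0" using lc by (auto simp: P_def)
  then have "P dvd P0" "P0 dvd P" by auto
  then have irr: "irreducible P" and dvd: "P dvd F n"
    using P0(1,2) irreducible_cong[of P P0] by (auto intro: dvd_trans associatedI)
  have Pz: "ev z P = 0" using P0(3) by (simp add: P_def ev_simps)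
  have "ev w P = 0 \<longleftrightarrow> primitive_root_of_unity n w" for w
  proof
    assume w: "ev w P = 0"
    obtain v where "F n = P * v" using dvd by (rule dvdE)
    then have "ev w (F n) = 0" using w by (simp add: ev_simps)
    then have "w ^ n = 1" by (simp add: evF)
    moreover have "w ^ t \<noteq> 1" if "0 < t" "t < n" for t
    proof
      assume "w ^ t = 1"
      then have "P dvd F t" using irreducible_root_dvd[OF irr w] by (simp add: evF)
      then obtain v where "F t = P * v" by (rule dvdE)
      then have "ev z (F t) = 0" using Pz by (simp add: ev_simps)
      with zt[OF that] show False by (simp add: evF)
    qed
    ultimately show "primitive_root_of_unity n w" using n by (simp add: primitive_root_of_unity_def)
  next
    assume w: "primitive_root_of_unity n w"
    then have "w ^ n = 1" by (simp add: primitive_root_of_unity_def)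
    then obtain k where k: "w = z ^ k" using primitive_root_cis(2)[OF n] by (auto simp: z_def)
    have "coprime k n"
    proof (rule ccontr)
      assume "\<not> coprime k n"
      define d where "d = gcd k n"
      have d1: "d \<noteq> 1" using \<open>\<not> coprime k n\<close> by (simp add: d_def coprime_iff_gcd_eq_1)
      obtain a where a: "k = d * a" unfolding d_def by (meson dvdE gcd_dvd1)
      obtain b where b: "n = d * b" unfolding d_def by (meson dvdE gcd_dvd2)
      have "d > 1" "b > 0" using d1 n b by (auto intro: Nat.gr0I simp: nat_neq_iff)
      then have "b < n" using b by simp
      have "w ^ b = (z ^ n) ^ a" by (simp add: k a b mult_ac flip: power_mult)
      then have "w ^ b = 1" by (simp add: zn)
      with w \<open>b > 0\<close> \<open>b < n\<close> show False by (simp add: primitive_root_of_unity_def)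
    qed
    then show "ev w P = 0" unfolding k by (rule root_power_coprime[OF irr monic n zn Pz])
  qed
  with irr monic show ?thesis by (auto simp: is_cyclotomic_poly_def)
qed

lemma is_cyclotomic_poly_unique:
  assumes n: "n > 0" and P: "is_cyclotomic_poly n P" and Q: "is_cyclotomic_poly n Q"
  shows "P = Q"
proof -
  define z where "z = cis (2 * pi / n)"
  have z: "primitive_root_of_unity n z" using primitive_root_cis(1)[OF n] by (simp add: z_def)
  have rt: "ev z P = 0" "ev z Q = 0" using P Q z by (auto simp: is_cyclotomic_poly_def)
  have irr: "irreducible P" "irreducible Q" and lc: "lead_coeff P = 1" "lead_coeff Q = 1"
    using P Q by (auto simp: is_cyclotomic_poly_def)
  have "P dvd Q" "Q dvd P" using irreducible_root_dvd irr rt by blast+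
  from \<open>Q dvd P\<close> obtain u where u: "P = Q * u" by (rule dvdE)
  have "degree P = degree Q"
    using \<open>P dvd Q\<close> \<open>Q dvd P\<close> lc by (intro antisym dvd_imp_degree_le) auto
  moreover have "Q \<noteq> 0" "u \<noteq> 0" using lc u by auto
  ultimately have "degree u = 0" by (simp add: u degree_mult_eq)
  moreover have "lead_coeff u = 1" using lc u by (simp add: lead_coeff_mult)
  ultimately have "u = 1" by (metis degree_eq_zeroE lead_coeff_pCons(2) one_pCons)
  then show ?thesis using u by simp
qed

theorem is_cyclotomic_poly_cyclotomic_poly:
  assumes "n > 0"
  shows "is_cyclotomic_poly n (cyclotomic_poly n)"
  unfolding cyclotomic_poly_def
  using is_cyclotomic_poly_exists[OF assms] is_cyclotomic_poly_unique[OF assms]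
  by (metis theI)

end

theory Submission
  imports Defs "HOL-Number_Theory.Cong"
begin

text \<open>
  For a modulus n and a residue r let \<open>F\<^sub>n(r)\<close> be the sum of the coefficients of A at exponents
  congruent to r, and let \<open>N(a)\<close> be the number of residues r modulo \<open>p ^ a\<close> with \<open>F(r)\<close> not divisible
  by q. The coefficients of A are non-negative, so \<open>A(1) \<ge> N(a)\<close> for all a, and \<open>N(0) = 1\<close>.
  A class modulo \<open>p ^ a\<close> is the disjoint union of p classes modulo \<open>p ^ (a + 1)\<close>, so \<open>N\<close> is
  non-decreasing. If the cyclotomic polynomial of order \<open>p ^ (a + 1) * q ^ b\<close> divides A, then
  modulo q, where \<open>q\<close>-power roots of unity collapse to 1, the polynomial \<open>X ^ p ^ (a + 1) - 1\<close>
  divides \<open>(X ^ p ^ a - 1) * A\<close>. Hence the p subclasses have congruent sums, and a class not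
  divisible by q splits into p such classes: \<open>N(a + 1) \<ge> p * N(a)\<close>. Finally, the exponent
  0 does not occur among the \<open>\<alpha>\<close>, since the cyclotomic polynomial of order \<open>q ^ b\<close> would force q to divide
  \<open>A(1)\<close>.
\<close>

section \<open>The polynomials X^n - 1 and roots of unity\<close>

definition cyc :: "nat \<Rightarrow> int poly" where
  "cyc n = monom 1 n - 1"

lemma degree_cyc [simp]: "n > 0 \<Longrightarrow> degree (cyc n) = n"
  unfolding cyc_def by (intro antisym degree_diff_le le_degree) (auto simp: degree_monom_eq)

lemma lead_coeff_cyc: "n > 0 \<Longrightarrow> lead_coeff (cyc n) = 1"
  by simp (simp add: cyc_def)

lemma ev_cyc: "ev z (cyc n) = z ^ n - 1"
  by (simp add: cyc_def ev_simps)

lemma poly_cyc: "poly (cyc n) x = x ^ n - 1"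
  by (simp add: cyc_def poly_monom)

lemma pcompose_monom:
  fixes g :: "'a :: comm_semiring_1 poly"
  shows "pcompose (monom c n) g = smult c (g ^ n)"
  by (induction n) (simp_all add: monom_0 monom_Suc pcompose_pCons)

lemma cyc_pcompose: "pcompose (cyc m) (monom 1 n) = cyc (m * n)"
  by (simp add: cyc_def pcompose_1 pcompose_diff pcompose_monom monom_power mult.commute)

lemma cyc_dvd_cyc_mult: "cyc n dvd cyc (n * k)"
proof -
  have "monom 1 n - 1 dvd (monom 1 n :: int poly) ^ k - 1"
    using power_diff_1_eq[of "monom 1 n :: int poly" k] by simp
  then show ?thesis by (simp add: cyc_def monom_power mult.commute)
qed

text \<open>Division by the monic \<open>cyc n\<close> leaves an integral remainder of degree below
  \<open>n\<close> that vanishes at all \<open>n\<close> roots of unity, hence is zero.\<close>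

lemma cyc_dvdI:
  assumes n: "n > 0" and roots: "\<And>z. z ^ n = 1 \<Longrightarrow> ev z f = 0"
  shows "cyc n dvd f"
proof -
  obtain g r where f: "f = cyc n * g + r" and r: "r = 0 \<or> degree r < degree (cyc n)"
    using monic_divmod[OF lead_coeff_cyc[OF n]] by blast
  have "r = 0"
  proof (rule ccontr)
    assume "r \<noteq> 0"
    let ?r = "map_poly of_int r :: complex poly"
    have deg: "degree ?r = degree r" by (simp add: degree_map_poly)
    have "?r \<noteq> 0"
      using \<open>r \<noteq> 0\<close> by (simp add: map_poly_eq_0_iff)
    have "{z. z ^ n = 1} \<subseteq> {z. poly ?r z = 0}"
    proof safe
      fix z :: complex assume z: "z ^ n = 1"
      then have "ev z (cyc n * g + r) = 0" using roots f by simp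
      then show "ev z r = 0" by (simp add: ev_add ev_mult ev_cyc z)
    qed
    then have "card {z :: complex. z ^ n = 1} \<le> card {z. poly ?r z = 0}"
      using \<open>?r \<noteq> 0\<close> by (intro card_mono poly_roots_finite)
    also have "\<dots> \<le> degree r" using card_poly_roots_bound[OF \<open>?r \<noteq> 0\<close>] deg by simp
    finally show False using card_roots_unity_eq[of n] n r \<open>r \<noteq> 0\<close> by simp
  qed
  then show ?thesis using f by simp
qed

text \<open>The order of \<open>z\<close> is a proper divisor of \<open>n\<close>; any prime factor
  of the cofactor serves as \<open>r\<close>.\<close>

lemma root_of_unity_cases:
  assumes z: "z ^ n = 1" and n: "n > 0" and np: "\<not> primitive_root_of_unity n z"
  obtains r where "prime r" "r dvd n" "z ^ (n div r) = 1"
proof -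
  define t where "t = (LEAST t. 0 < t \<and> z ^ t = 1)"
  have t: "0 < t" "z ^ t = 1"
    using LeastI[of "\<lambda>t. 0 < t \<and> z ^ t = 1" n] z n by (auto simp: t_def)
  have tmin: "t \<le> s" if "0 < s" "z ^ s = 1" for s
    using Least_le[of "\<lambda>t. 0 < t \<and> z ^ t = 1" s] that by (auto simp: t_def)
  have "z ^ (t * (n div t) + n mod t) = 1" using z by simp
  then have "z ^ (n mod t) = 1" using t(2) by (simp only: power_add power_mult) simp
  then have "t dvd n" using tmin[of "n mod t"] t(1) mod_less_divisor[of t n]
    by (metis dvd_eq_mod_eq_0 leD neq0_conv)
  then obtain s where s: "n = t * s" by (rule dvdE)
  have "s \<noteq> 1"
  proof
    assume "s = 1"
    then have "primitive_root_of_unity n z" unfolding primitive_root_of_unity_def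
      using z n tmin s by (metis leD mult.right_neutral)
    with np show False ..
  qed
  then obtain r where r: "prime r" "r dvd s" using prime_factor_nat by blast
  then obtain l where l: "s = r * l" by (auto elim: dvdE)
  have "n div r = t * l" using s l r(1) by (simp add: prime_gt_0_nat)
  then have "z ^ (n div r) = 1" by (simp add: power_mult t)
  then show ?thesis using r s that by auto
qed

lemma cyclotomic_poly_dvd_root:
  assumes "n > 0" "cyclotomic_poly n dvd f" "primitive_root_of_unity n z"
  shows "ev z f = 0"
proof -
  have "ev z (cyclotomic_poly n) = 0"
    using is_cyclotomic_poly_cyclotomic_poly[OF assms(1)] assms(3)
    by (auto simp: is_cyclotomic_poly_def)
  with assms(2) show ?thesis by (auto elim!: dvdE simp: ev_mult)
qed

section \<open>Congruences in Z[X] modulo the ideal generated by \<open>q\<close> and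
  \<open>g\<close>\<close>

definition in_ideal :: "nat \<Rightarrow> int poly \<Rightarrow> int poly \<Rightarrow> bool" where
  "in_ideal q g f \<longleftrightarrow> (\<exists>u. of_nat q dvd f - g * u)"

lemma in_ideal_dvd: "g dvd f \<Longrightarrow> in_ideal q g f"
  unfolding in_ideal_def by (metis cancel_comm_monoid_add_class.diff_cancel dvdE dvd_0_right)

lemma in_ideal_of_nat_dvd: "of_nat q dvd f \<Longrightarrow> in_ideal q g f"
  unfolding in_ideal_def by (intro exI[of _ 0]) simp

lemma in_ideal_add: 
  assumes "in_ideal q g f" "in_ideal q g h"
  shows "in_ideal q g (f + h)"
proof -
  obtain u v where "of_nat q dvd f - g * u" "of_nat q dvd h - g * v"
    using assms by (auto simp: in_ideal_def)
  from dvd_add[OF this] show ?thesis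
    unfolding in_ideal_def by (intro exI[of _ "u + v"]) (simp add: algebra_simps)
qed

lemma in_ideal_mult: 
  assumes "in_ideal q g f"
  shows "in_ideal q g (h * f)"
proof -
  obtain u where "of_nat q dvd f - g * u"
    using assms by (auto simp: in_ideal_def)
  from dvd_mult[OF this, of h] show ?thesis
    unfolding in_ideal_def by (intro exI[of _ "h * u"]) (simp add: algebra_simps)
qed

lemma frobenius_poly_power:
  fixes f :: "int poly"
  assumes q: "prime q"
  shows "of_nat q dvd f ^ (q ^ t) - pcompose f (monom 1 (q ^ t))"
proof (induction t)
  case 0
  then show ?case by (simp add: pcompose_idR monom_altdef)
next
  case (Suc t)
  let ?g = "pcompose f (monom 1 (q ^ t))"
  have "f ^ (q ^ t) - ?g dvd (f ^ (q ^ t)) ^ q - ?g ^ q"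
    by (simp add: power_diff_sumr2)
  with Suc have "of_nat q dvd (f ^ (q ^ t)) ^ q - ?g ^ q" by (rule dvd_trans)
  moreover have "of_nat q dvd ?g ^ q - pcompose ?g (monom 1 q)" by (rule frobenius_poly[OF q])
  ultimately have "of_nat q dvd (f ^ (q ^ t)) ^ q - pcompose ?g (monom 1 q)"
    using dvd_add by fastforce
  moreover have "pcompose ?g (monom 1 q) = pcompose f (monom 1 (q ^ Suc t))"
    by (simp add: pcompose_assoc[symmetric] pcompose_monom monom_power)
  ultimately show ?case by (simp add: power_mult[symmetric] mult.commute)
qed

text \<open>Modulo X^n - 1 the power X^(nk+1) equals X, so substituting it for X changes
  nothing.\<close>

lemma pcompose_monom_diff_dvd:
  "cyc n dvd pcompose f (monom 1 (Suc (n * k))) - f"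
proof (induction f)
  case 0
  then show ?case by simp
next
  case (pCons a f)
  let ?Q = "Suc (n * k)"
  have "pcompose (pCons a f) (monom 1 ?Q) - pCons a f =
     monom 1 ?Q * (pcompose f (monom 1 ?Q) - f) + (cyc (n * k) * monom 1 1) * f"
  proof -
    have X: "pCons a f = [:a:] + monom 1 1 * f" by (simp add: monom_altdef)
    have "monom 1 ?Q = (monom 1 (n * k) * monom 1 1 :: int poly)"
      by (simp add: mult_monom)
    then show ?thesis by (subst (2) X) (simp add: pcompose_pCons cyc_def algebra_simps)
  qed
  then show ?case using pCons(2) cyc_dvd_cyc_mult[of n k] by (simp add: dvd_mult dvd_mult2)
qed

text \<open>Modulo \<open>q\<close> the ring Z[X] becomes a domain in which the monic
  \<open>cyc n\<close> is nonzero, so its powers can be cancelled.\<close>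

lemma of_nat_prime_dvd_mult_cyc_power:
  assumes q: "prime q" and n: "n > 0" and d: "of_nat q dvd cyc n ^ i * f"
  shows "of_nat q dvd f"
proof -
  have "prime_elem (of_nat q :: int poly)"
    using q by (simp add: of_nat_poly prime_elem_const_poly_iff)
  moreover have "\<not> of_nat q dvd cyc n ^ i"
  proof
    assume "of_nat q dvd cyc n ^ i"
    then have "[:int q:] dvd cyc n ^ i" by (simp add: of_nat_poly)
    then have "int q dvd lead_coeff (cyc n ^ i)" by (simp only: const_poly_dvd_iff)
    then have "int q dvd 1" unfolding lead_coeff_power lead_coeff_cyc[OF n] by simp
    with q show False by (simp add: prime_gt_1_nat)
  qed
  ultimately show ?thesis using d by (simp add: prime_elem_dvd_mult_iff)
qed

text \<open>Modulo the prime q, the Frobenius map turns the hypothesis into a relation between powers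
  of \<open>cyc n\<close>, of which all but a positive power cancels.\<close>

lemma in_ideal_cancel:
  assumes q: "prime q" and n: "n > 0" and dvd: "cyc (n * q ^ Suc b) dvd f * cyc (n * q ^ b)"
  shows "in_ideal q (cyc n) f"
proof -
  obtain h where h: "f * cyc (n * q ^ b) = cyc (n * q ^ Suc b) * h" using dvd by (rule dvdE)
  let ?Y = "cyc n"
  have 1: "of_nat q dvd ?Y ^ (q ^ t) - cyc (n * q ^ t)" for t
    using frobenius_poly_power[OF q, of ?Y t] by (simp add: cyc_pcompose)
  have "of_nat q dvd (?Y ^ (q ^ b) - cyc (n * q ^ b)) * f - (?Y ^ (q ^ Suc b) - cyc (n * q ^ Suc b)) * h"
    by (intro dvd_diff dvd_mult2 1)
  also have "\<dots> = ?Y ^ (q ^ b) * f - ?Y ^ (q ^ Suc b) * h"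
    using h by (simp add: algebra_simps)
  also have "?Y ^ (q ^ Suc b) = ?Y ^ (q ^ b) * (?Y ^ (q ^ Suc b - q ^ b))"
    using prime_gt_0_nat[OF q] by (simp flip: power_add)
  also have "?Y ^ (q ^ b) * f - ?Y ^ (q ^ b) * (?Y ^ (q ^ Suc b - q ^ b)) * h =
     ?Y ^ (q ^ b) * (f - (?Y ^ (q ^ Suc b - q ^ b)) * h)" by (simp add: algebra_simps)
  finally have 2: "of_nat q dvd f - (?Y ^ (q ^ Suc b - q ^ b)) * h"
    using of_nat_prime_dvd_mult_cyc_power[OF q n] by blast
  have "0 < q ^ Suc b - q ^ b" using prime_gt_1_nat[OF q] by simp
  then obtain e where "q ^ Suc b - q ^ b = Suc e" using gr0_implies_Suc by blast
  then have "?Y ^ (q ^ Suc b - q ^ b) = ?Y * ?Y ^ e" by (simp only: power_Suc)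
  with 2 show ?thesis unfolding in_ideal_def by (metis mult.assoc)
qed

text \<open>Pigeonhole: two of the \<open>n + 1\<close> powers with exponents up to \<open>n\<close>
  agree modulo \<open>n\<close>, and the smaller one cancels by coprimality.\<close>

lemma ex_power_cong_1:
  fixes q n :: nat
  assumes n: "n > 0" and cop: "coprime q n"
  obtains t where "t > 0" "[q ^ t = 1] (mod n)"
proof -
  have "\<not> inj_on (\<lambda>i. q ^ i mod n) {..n}"
  proof
    assume "inj_on (\<lambda>i. q ^ i mod n) {..n}"
    moreover have "(\<lambda>i. q ^ i mod n) ` {..n} \<subseteq> {..<n}" using n by auto
    ultimately have "card {..n} \<le> card {..<n}" by (rule card_inj_on_le) simp
    then show False by simp
  qed
  then obtain i j where "i < j" and ij: "[q ^ i = q ^ j] (mod n)"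
    by (auto simp: inj_on_def cong_def nat_neq_iff)
  have "q ^ j = q ^ i * q ^ (j - i)" using \<open>i < j\<close> by (simp flip: power_add)
  with ij have "[q ^ i * q ^ (j - i) = q ^ i * 1] (mod n)" by (simp add: cong_sym)
  moreover have "coprime (q ^ i) n" using cop by simp
  ultimately have "[q ^ (j - i) = 1] (mod n)"
    by (simp only: cong_mult_lcancel_nat)
  with \<open>i < j\<close> that[of "j - i"] show ?thesis by simp
qed

text \<open>Choosing t with \<open>q ^ t\<close> congruent to 1 modulo n makes \<open>f ^ (q ^ t)\<close> equal to f in the quotient,
  so no separability argument over a finite field is needed.\<close>

lemma in_ideal_reduced:
  assumes q: "prime q" and cop: "coprime q n" and n: "n > 0" and f: "in_ideal q (cyc n) (f ^ i)"
  shows "in_ideal q (cyc n) f"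
proof -
  obtain s where s: "s > 0" "[q ^ s = 1] (mod n)" using ex_power_cong_1[OF n cop] .
  \<comment> \<open>A multiple of \<open>s\<close> keeps \<open>q ^ t\<close> congruent to 1, and
    the factor \<open>i\<close> makes \<open>q ^ t\<close> exceed \<open>i\<close>, so that
    \<open>f ^ i\<close> divides \<open>f ^ (q ^ t)\<close>.\<close>
  define t where "t = i * s"
  have "i \<le> t" using s(1) by (simp add: t_def)
  also have "t < q ^ t" using prime_gt_1_nat[OF q] by (intro power_gt_expt) simp
  finally have "f ^ (q ^ t) = f ^ (q ^ t - i) * f ^ i" by (simp flip: power_add)
  then have 1: "in_ideal q (cyc n) (f ^ (q ^ t))" using in_ideal_mult[OF f] by simp
  have "[q ^ t = 1] (mod n)"
    using cong_pow[OF s(2), of i] by (simp add: t_def mult.commute flip: power_mult)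
  then have "n dvd q ^ t - 1" using prime_gt_0_nat[OF q]
    by (subst (asm) cong_altdef_nat) auto
  then obtain k where "q ^ t - 1 = n * k" by (rule dvdE)
  then have "q ^ t = Suc (n * k)" using prime_gt_0_nat[OF q] by (metis Suc_pred' zero_less_power One_nat_def)
  then have 2: "cyc n dvd pcompose f (monom 1 (q ^ t)) - f" using pcompose_monom_diff_dvd by simp
  \<comment> \<open>The sum telescopes to \<open>f\<close>, and each of its three terms lies in the
    ideal.\<close>
  have "in_ideal q (cyc n) (f ^ (q ^ t) + (-1) * (f ^ (q ^ t) - pcompose f (monom 1 (q ^ t)))
      + (-1) * (pcompose f (monom 1 (q ^ t)) - f))"
    by (intro in_ideal_add in_ideal_mult 1 in_ideal_of_nat_dvd[OF frobenius_poly_power[OF q]]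
        in_ideal_dvd[OF 2])
  then show ?thesis by simp
qed

section \<open>From cyclotomic divisors to congruences modulo \<open>q\<close>\<close>

lemma cyclotomic_poly_dvd_cases:
  assumes p: "prime p" and q: "prime q"
    and dvd: "cyclotomic_poly (p ^ a * q ^ b) dvd A" and z: "z ^ (p ^ a * q ^ b) = 1"
  obtains "ev z A = 0"
    | a' where "a = Suc a'" "z ^ (p ^ a' * q ^ b) = 1"
    | b' where "b = Suc b'" "z ^ (p ^ a * q ^ b') = 1"
proof (cases "primitive_root_of_unity (p ^ a * q ^ b) z")
  case True
  then show ?thesis using cyclotomic_poly_dvd_root[OF _ dvd] p q that(1) by (simp add: prime_gt_0_nat)
next
  case False
  then obtain r where r: "prime r" "r dvd p ^ a * q ^ b" "z ^ (p ^ a * q ^ b div r) = 1"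
    using root_of_unity_cases[OF z] p q by (auto simp: prime_gt_0_nat)
  from r(1,2) have "r dvd p ^ a \<or> r dvd q ^ b" by (simp add: prime_dvd_mult_iff)
  then show ?thesis
  proof
    assume "r dvd p ^ a"
    then have "a \<noteq> 0" "r = p" using r(1) p
      by (metis not_prime_unit power_0, metis prime_dvd_power primes_dvd_imp_eq)
    then show ?thesis using that(2)[of "a - 1"] r(3) prime_gt_0_nat[OF p] by (cases a) auto
  next
    assume "r dvd q ^ b"
    then have "b \<noteq> 0" "r = q" using r(1) q
      by (metis not_prime_unit power_0, metis prime_dvd_power primes_dvd_imp_eq)
    then show ?thesis using that(3)[of "b - 1"] r(3) prime_gt_0_nat[OF q] by (cases b) auto
  qed
qed

text \<open>Vanishing at all roots of unity of order dividing \<open>p ^ Suc a * q ^ b\<close> gives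
  a divisibility, which modulo \<open>q\<close> puts \<open>cyc (p ^ a) ^ (q ^ b) * A\<close> into
  the ideal. Absence of nilpotents then removes the exponent.\<close>

lemma in_ideal_cyc_mult:
  assumes p: "prime p" and q: "prime q" and pq: "p \<noteq> q"
    and dvd: "cyclotomic_poly (p ^ Suc a * q ^ b) dvd A"
  shows "in_ideal q (cyc (p ^ Suc a)) (cyc (p ^ a) * A)"
proof -
  let ?P = "p ^ Suc a" and ?W = "cyc (p ^ a)"
  have pos: "p > 0" "q > 0" using p q by (auto simp: prime_gt_0_nat)
  have "in_ideal q (cyc ?P) (?W ^ (q ^ b) * A)"
  proof (cases b)
    case 0
    have "cyc ?P dvd ?W * A"
    proof (rule cyc_dvdI)
      fix z :: complex assume "z ^ ?P = 1"
      with 0 have z': "z ^ (?P * q ^ b) = 1" by simp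
      show "ev z (?W * A) = 0"
        by (rule cyclotomic_poly_dvd_cases[OF p q dvd z']) (use 0 in \<open>simp_all add: ev_mult ev_cyc\<close>)
    qed (use pos in simp)
    then show ?thesis using 0 by (simp add: in_ideal_dvd)
  next
    case (Suc c)
    \<comment> \<open>The first factor kills the roots of order dividing
      \<open>p ^ a * q ^ b\<close>, the last one those of order dividing \<open>?P * q ^ c\<close>,
      and \<open>A\<close> the primitive ones. Modulo \<open>q\<close> the last factor
      cancels.\<close>
    have "cyc (?P * q ^ Suc c) dvd (cyc (p ^ a * q ^ b) * A) * cyc (?P * q ^ c)"
    proof (rule cyc_dvdI)
      fix z :: complex assume "z ^ (?P * q ^ Suc c) = 1"
      with Suc have z': "z ^ (?P * q ^ b) = 1" by simp
      show "ev z ((cyc (p ^ a * q ^ b) * A) * cyc (?P * q ^ c)) = 0"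
        by (rule cyclotomic_poly_dvd_cases[OF p q dvd z']) (use Suc in \<open>simp_all add: ev_mult ev_cyc\<close>)
    qed (use pos in simp)
    then have 1: "in_ideal q (cyc ?P) (cyc (p ^ a * q ^ b) * A)"
      using in_ideal_cancel[OF q] pos by simp
    have "of_nat q dvd (?W ^ (q ^ b) - cyc (p ^ a * q ^ b)) * A"
      using frobenius_poly_power[OF q, of ?W b] by (simp add: cyc_pcompose dvd_mult2)
    from in_ideal_add[OF 1 in_ideal_of_nat_dvd[OF this]] show ?thesis
      by (simp add: algebra_simps)
  qed
  \<comment> \<open>Multiplying by a power of \<open>A\<close> completes the product to a
    \<open>q ^ b\<close>-th power, as \<open>in_ideal_reduced\<close> requires.\<close>
  then have "in_ideal q (cyc ?P) (A ^ (q ^ b - 1) * (?W ^ (q ^ b) * A))" by (rule in_ideal_mult)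
  also have "A ^ (q ^ b - 1) * (?W ^ (q ^ b) * A) = (?W * A) ^ (q ^ b)"
  proof -
    have "A ^ (q ^ b) = A ^ (q ^ b - 1) * A" using pos by (simp flip: power_Suc2)
    then show ?thesis by (simp add: power_mult_distrib algebra_simps)
  qed
  finally have "in_ideal q (cyc ?P) ((?W * A) ^ (q ^ b))" .
  moreover have "coprime q ?P" using primes_coprime[OF q p] pq by simp
  ultimately show ?thesis using in_ideal_reduced[OF q] pos by simp
qed

text \<open>Modulo \<open>q\<close> the roots of order dividing \<open>q ^ b\<close> collapse to 1,
  which places \<open>A\<close> in the ideal generated by \<open>q\<close> and X - 1; evaluation at
  1 finishes.\<close>

lemma cyclotomic_poly_prime_power_dvd:
  assumes q: "prime q" and dvd: "cyclotomic_poly (q ^ b) dvd A"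
  shows "int q dvd poly A 1"
proof -
  \<comment> \<open>Here \<open>q\<close> takes both prime roles; its first exponent 0 excludes the
    second alternative of \<open>cyclotomic_poly_dvd_cases\<close>.\<close>
  have dvd': "cyclotomic_poly (q ^ 0 * q ^ b) dvd A" using dvd by simp
  have "in_ideal q (cyc 1) A"
  proof (cases b)
    case 0
    have "cyc 1 dvd A"
    proof (rule cyc_dvdI)
      fix z :: complex assume "z ^ 1 = 1"
      with 0 have z': "z ^ (q ^ 0 * q ^ b) = 1" by simp
      show "ev z A = 0"
        by (rule cyclotomic_poly_dvd_cases[OF q q dvd' z']) (use 0 in \<open>simp_all add: ev_mult ev_cyc\<close>)
    qed simp
    then show ?thesis by (rule in_ideal_dvd)
  next
    case (Suc c)
    have "cyc (1 * q ^ Suc c) dvd A * cyc (1 * q ^ c)"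
    proof (rule cyc_dvdI)
      fix z :: complex assume "z ^ (1 * q ^ Suc c) = 1"
      with Suc have z': "z ^ (q ^ 0 * q ^ b) = 1" by simp
      show "ev z (A * cyc (1 * q ^ c)) = 0"
        by (rule cyclotomic_poly_dvd_cases[OF q q dvd' z']) (use Suc in \<open>simp_all add: ev_mult ev_cyc\<close>)
    qed (use q in \<open>simp add: prime_gt_0_nat\<close>)
    then show ?thesis using in_ideal_cancel[OF q] by simp
  qed
  then obtain u v where "A - cyc 1 * u = of_nat q * v" unfolding in_ideal_def by (auto elim: dvdE)
  then have "poly (A - cyc 1 * u) 1 = poly (of_nat q * v) 1" by simp
  then show ?thesis by (simp add: poly_cyc)
qed

section \<open>Weighted coefficient sums and sums over residue classes\<close>

definition wsum :: "(nat \<Rightarrow> int) \<Rightarrow> int poly \<Rightarrow> int" where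
  "wsum w f = (\<Sum>i\<le>degree f. w i * coeff f i)"

lemma wsum_0 [simp]: "wsum w 0 = 0"
  by (simp add: wsum_def)

lemma wsum_pCons: "wsum w (pCons a f) = w 0 * a + wsum (\<lambda>i. w (Suc i)) f"
proof (cases "f = 0")
  case False
  then show ?thesis by (simp add: wsum_def sum.atMost_Suc_shift del: sum.atMost_Suc)
qed (simp add: wsum_def)

lemma wsum_add: "wsum w (f + g) = wsum w f + wsum w g"
  by (induction f g arbitrary: w rule: poly_induct2) (simp_all add: wsum_pCons algebra_simps)

lemma wsum_smult: "wsum w (smult c f) = c * wsum w f"
  by (induction f arbitrary: w) (simp_all add: wsum_pCons algebra_simps)

lemma wsum_diff: "wsum w (f - g) = wsum w f - wsum w g"
  using wsum_add[of w f "smult (-1) g"] wsum_smult[of w "-1" g] by simp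

lemma wsum_monom_mult: "wsum w (monom 1 n * f) = wsum (\<lambda>i. w (i + n)) f"
  by (induction n arbitrary: w) (simp_all add: monom_0 monom_Suc wsum_pCons)

lemma wsum_cyc_mult: "wsum w (cyc n * f) = wsum (\<lambda>i. w (i + n)) f - wsum w f"
  by (simp add: cyc_def left_diff_distrib wsum_diff wsum_monom_mult)

text \<open>Periodic weights annihilate multiples of \<open>cyc n\<close>, since multiplication by
  X^n only shifts the weights by \<open>n\<close>.\<close>

lemma in_ideal_wsum:
  assumes "in_ideal q (cyc n) f" and "\<And>i. w (i + n) = w i"
  shows "int q dvd wsum w f"
proof -
  obtain u v where "f - cyc n * u = of_nat q * v"
    using assms(1) unfolding in_ideal_def by (auto elim: dvdE)
  then have "f = cyc n * u + smult (int q) v" by (simp add: of_nat_poly algebra_simps)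
  then show ?thesis by (simp add: wsum_add wsum_smult wsum_cyc_mult assms(2))
qed

definition class_sum :: "int poly \<Rightarrow> nat \<Rightarrow> nat \<Rightarrow> int" where
  "class_sum f n r = wsum (\<lambda>i. of_bool ([i = r] (mod n))) f"

lemma class_sum_nonneg: "(\<And>i. coeff f i \<ge> 0) \<Longrightarrow> class_sum f n r \<ge> 0"
  unfolding class_sum_def wsum_def by (intro sum_nonneg) simp

lemma class_sum_1: "class_sum f 1 r = poly f 1"
  by (simp add: class_sum_def wsum_def poly_altdef)

lemma add_mult_less: "r < m \<Longrightarrow> s < k \<Longrightarrow> r + s * m < k * m" for r m s k :: nat
  using mult_le_mono1[of "Suc s" k m] by simp

text \<open>Division with remainder: a residue modulo \<open>k * m\<close> amounts to a residue
  \<open>r\<close> modulo \<open>m\<close> together with a quotient digit \<open>s\<close>.\<close>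

lemma cong_mult_iff:
  fixes i r m k s :: nat
  assumes "r < m" "s < k"
  shows "[i = r + s * m] (mod (k * m)) \<longleftrightarrow> [i = r] (mod m) \<and> s = (i div m) mod k"
proof -
  have "(r + s * m) mod (k * m) = m * s + r" using add_mult_less[OF assms] by simp
  moreover have "i mod (k * m) = m * (i div m mod k) + i mod m"
    using mod_mult2_eq[of i m k] by (simp add: mult.commute)
  moreover have "m * x + i mod m = m * s + r \<longleftrightarrow> i mod m = r \<and> s = x" for x
  proof
    assume eq: "m * x + i mod m = m * s + r"
    have "(m * x + i mod m) mod m = r" "(m * x + i mod m) div m = s"
      using assms(1) by (simp_all add: eq)
    then show "i mod m = r \<and> s = x" using assms(1) by simp
  qed simp
  ultimately show ?thesis using assms(1) by (simp add: cong_def)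
qed

lemma class_sum_split:
  assumes "r < m" "k > 0"
  shows "class_sum f m r = (\<Sum>s<k. class_sum f (k * m) (r + s * m))"
proof -
  have "(\<Sum>s<k. of_bool ([i = r + s * m] (mod (k * m)))) = (of_bool ([i = r] (mod m)) :: int)" for i
  proof -
    have "(\<Sum>s<k. of_bool ([i = r + s * m] (mod (k * m)))) =
        (\<Sum>s<k. if s = (i div m) mod k then of_bool ([i = r] (mod m)) else 0 :: int)"
      using assms(1) by (intro sum.cong) (auto simp: cong_mult_iff)
    also have "\<dots> = of_bool ([i = r] (mod m))" using assms(2) by simp
    finally show ?thesis .
  qed
  then show ?thesis
    unfolding class_sum_def wsum_def
    by (subst sum.swap) (simp flip: sum_distrib_right)
qed

section \<open>Counting the residue classes whose sum is nonzero modulo \<open>q\<close>\<close>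

definition nonzero_classes :: "nat \<Rightarrow> int poly \<Rightarrow> nat \<Rightarrow> nat set" where
  "nonzero_classes q f n = {r. r < n \<and> \<not> int q dvd class_sum f n r}"

lemma finite_nonzero_classes [simp]: "finite (nonzero_classes q f n)"
  by (simp add: nonzero_classes_def)

text \<open>A non-negative integer not divisible by \<open>q\<close> is at least 1, and all class
  sums modulo \<open>n\<close> add up to the value at 1.\<close>

lemma card_nonzero_classes_le:
  assumes "\<And>i. coeff f i \<ge> 0" and "n > 0"
  shows "int (card (nonzero_classes q f n)) \<le> poly f 1"
proof -
  have "int (card (nonzero_classes q f n)) = (\<Sum>r\<in>nonzero_classes q f n. 1)" by simp
  also have "\<dots> \<le> (\<Sum>r\<in>nonzero_classes q f n. class_sum f n r)"
  proof (rule sum_mono)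
    fix r assume "r \<in> nonzero_classes q f n"
    then have "class_sum f n r \<noteq> 0" by (auto simp: nonzero_classes_def)
    then show "1 \<le> class_sum f n r" using class_sum_nonneg[of f n r] assms(1) by simp
  qed
  also have "\<dots> \<le> (\<Sum>r<n. class_sum f n r)"
    using assms(1) by (intro sum_mono2) (auto simp: nonzero_classes_def class_sum_nonneg)
  also have "\<dots> = poly f 1"
    using class_sum_split[of 0 1 n f] assms(2) class_sum_1[of f 0] by simp
  finally show ?thesis .
qed

lemma nonzero_classes_lift:
  assumes "r \<in> nonzero_classes q f m" "k > 0"
  obtains s where "s < k" "\<not> int q dvd class_sum f (k * m) (r + s * m)"
  using assms class_sum_split[of r m k f] by (auto simp: nonzero_classes_def intro: dvd_sum)

text \<open>Every counted class modulo \<open>m\<close> has a counted subclass, so reduction modulo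
  \<open>m\<close> covers the coarser set.\<close>

lemma card_nonzero_classes_mono:
  assumes "k > 0"
  shows "card (nonzero_classes q f m) \<le> card (nonzero_classes q f (k * m))"
proof (rule surj_card_le)
  show "nonzero_classes q f m \<subseteq> (\<lambda>x. x mod m) ` nonzero_classes q f (k * m)"
  proof
    fix r assume r: "r \<in> nonzero_classes q f m"
    then obtain s where "s < k" "\<not> int q dvd class_sum f (k * m) (r + s * m)"
      using nonzero_classes_lift assms by blast
    with r have "r + s * m \<in> nonzero_classes q f (k * m)" "r = (r + s * m) mod m"
      by (auto simp: nonzero_classes_def add_mult_less)
    then show "r \<in> (\<lambda>x. x mod m) ` nonzero_classes q f (k * m)" by blast
  qed
qed simp

lemma card_nonzero_classes_mult:
  assumes k: "k > 0" and f: "in_ideal q (cyc (k * m)) (cyc m * f)"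
  shows "k * card (nonzero_classes q f m) \<le> card (nonzero_classes q f (k * m))"
proof -
  let ?h = "\<lambda>(r, s). r + s * m"
  let ?F = "class_sum f (k * m)"
  have step: "int q dvd ?F r - ?F (r + m)" for r
  proof -
    \<comment> \<open>Shifting this weight by \<open>m\<close> turns it into the indicator of
      \<open>r\<close>, so pairing it with \<open>cyc m * f\<close> gives the difference of two
      neighbouring subclass sums.\<close>
    let ?w = "\<lambda>i. of_bool ([i = r + m] (mod (k * m))) :: int"
    have "[i + k * m = r + m] (mod (k * m)) \<longleftrightarrow> [i = r + m] (mod (k * m))" for i
      by (simp add: cong_def)
    then have "int q dvd wsum ?w (cyc m * f)" by (intro in_ideal_wsum[OF f]) simp
    then show ?thesis by (simp add: wsum_cyc_mult class_sum_def cong_add_rcancel_nat)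
  qed
  have steps: "int q dvd ?F r - ?F (r + s * m)" for r s
  proof (induction s)
    case (Suc s)
    from dvd_add[OF Suc step[of "r + s * m"]] show ?case by (simp add: algebra_simps)
  qed simp
  have "?h ` (nonzero_classes q f m \<times> {..<k}) \<subseteq> nonzero_classes q f (k * m)"
  proof safe
    fix r t assume r: "r \<in> nonzero_classes q f m" and t: "t < k"
    obtain s where "\<not> int q dvd ?F (r + s * m)" using nonzero_classes_lift[OF r k] by blast
    \<comment> \<open>The subclass of \<open>r\<close> itself is the pivot between the surviving
      subclass \<open>s\<close> and an arbitrary \<open>t\<close>.\<close>
    then have "\<not> int q dvd ?F r" using steps[of r s] dvd_diff_right_iff by blast
    then have "\<not> int q dvd ?F (r + t * m)" using steps[of r t] dvd_diff_left_iff by blast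
    then show "r + t * m \<in> nonzero_classes q f (k * m)"
      using r t by (simp add: nonzero_classes_def add_mult_less)
  qed
  moreover have "inj_on ?h (nonzero_classes q f m \<times> {..<k})"
  proof (rule inj_on_inverseI)
    fix x assume "x \<in> nonzero_classes q f m \<times> {..<k}"
    then show "(\<lambda>y. (y mod m, y div m)) (?h x) = x" by (auto simp: nonzero_classes_def)
  qed
  ultimately have "card (nonzero_classes q f m \<times> {..<k}) \<le> card (nonzero_classes q f (k * m))"
    by (intro card_inj_on_le) auto
  then show ?thesis by (simp add: card_cartesian_product mult.commute)
qed

theorem theorem1p2:
  fixes A :: "int poly" and k p q :: nat and m \<alpha> \<beta> :: "nat \<Rightarrow> nat"
  assumes "\<forall>i. coeff A i \<ge> 0"
    and "inj_on (\<lambda>j. cyclotomic_poly (m j)) {1..k}"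
    and "\<forall>j\<in>{1..k}. cyclotomic_poly (m j) dvd A"
    and "prime p" and "prime q" and "p \<noteq> q"
    and "\<forall>j\<in>{1..k}. m j = p ^ \<alpha> j * q ^ \<beta> j"
    and "\<not> int q dvd poly A 1"
  shows "poly A 1 \<ge> int p ^ card (\<alpha> ` {1..k})"
proof -
  have p0: "p > 0" using \<open>prime p\<close> by (simp add: prime_gt_0_nat)
  let ?S = "\<alpha> ` {1..k}" and ?N = "\<lambda>a. card (nonzero_classes q A (p ^ a))"
  have dvd: "cyclotomic_poly (p ^ \<alpha> j * q ^ \<beta> j) dvd A" if "j \<in> {1..k}" for j
    using assms(3,7) that by simp
  have "\<alpha> j \<noteq> 0" if "j \<in> {1..k}" for j
    using cyclotomic_poly_prime_power_dvd[OF \<open>prime q\<close>, of "\<beta> j" A] dvd[OF that] assms(8)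
    by (cases "\<alpha> j") auto
  then have S0: "0 \<notin> ?S" by force
  \<comment> \<open>Each occurring exponent up to \<open>a\<close> contributes a factor
    \<open>p\<close>; the other levels use only monotonicity.\<close>
  have *: "p ^ card (?S \<inter> {..a}) \<le> ?N a" for a
  proof (induction a)
    case 0
    have "nonzero_classes q A 1 = {0}"
      using assms(8) class_sum_1[of A 0] by (auto simp: nonzero_classes_def)
    moreover have "?S \<inter> {..0} = {}" using S0 by auto
    ultimately show ?case by simp
  next
    case (Suc a)
    show ?case
    proof (cases "Suc a \<in> ?S")
      case True
      then obtain j where j: "j \<in> {1..k}" "\<alpha> j = Suc a" by auto
      have "in_ideal q (cyc (p * p ^ a)) (cyc (p ^ a) * A)"
        using in_ideal_cyc_mult[OF assms(4-6), of a "\<beta> j" A] dvd[OF j(1)] j(2) by simp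
      then have "p * ?N a \<le> ?N (Suc a)" using card_nonzero_classes_mult[OF p0] by simp
      with mult_le_mono2[OF Suc] have "p * p ^ card (?S \<inter> {..a}) \<le> ?N (Suc a)"
        by (rule le_trans)
      moreover have "?S \<inter> {..Suc a} = insert (Suc a) (?S \<inter> {..a})" using True by auto
      ultimately show ?thesis by simp
    next
      case False
      then have "?S \<inter> {..Suc a} = ?S \<inter> {..a}" unfolding atMost_Suc by (rule Int_insert_right_if0)
      then show ?thesis using Suc card_nonzero_classes_mono[OF p0, of q A "p ^ a"] by simp
    qed
  qed
  \<comment> \<open>For \<open>k = 0\<close> the set is empty and its \<open>Max\<close>
    unspecified, but both sides are then empty and the bound at any level suffices.\<close>
  have "?S \<inter> {..Max ?S} = ?S" by auto
  then have "int (p ^ card ?S) \<le> int (?N (Max ?S))" using *[of "Max ?S"] by simp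
  also have "\<dots> \<le> poly A 1" using assms(1) p0 by (intro card_nonzero_classes_le) auto
  finally show ?thesis by simp
qed

end
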